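(* There exists an absolute constant $C>0$ such that for every integer $m$, $\varepsilon>0$ and $2\le p\le\infty$, for all $x_1,\ldots,x_m$ in the unit ball of $\ell_2$, $$\log N(\mathrm{absconv}\{x_1,\ldots,x_m\},\varepsilon B_p)\le C\,\frac{\log m}{\varepsilon^{p/(p-1)}}.$$
   Context: For a real sequence $x=(x_i)_{i\ge1}$, $\|x\|_p=(\sum_i|x_i|^p)^{1/p}$ for $0<p<\infty$ and $\|x\|_\infty=\sup_i|x_i|$; $\ell_p$ is the space of sequences with $\|x\|_p<\infty$, and $B_p=\{x\in\mathbb{R}^{\mathbb{N}}:\|x\|_p\le1\}$. For convex sets $K,L\subset\ell_\infty$, $N(K,L)$ is the minimal number of translates of $L$ required to cover $K$ (possibly infinite). For $A\subset\ell_\infty$, $\mathrm{absconv}(A)$ is the convex hull of $A\cup(-A)$. For $p=\infty$ the exponent $p/(p-1)$ is read as $1$.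
   Formalization: The formal statement takes m ≥ 2 instead of every integer m: for m = 1 the bound is false (x_1 = e_1, ε = 1/2 needs at least two translates while log m = 0), and for m ≤ 0 log m is undefined. *)

theory Defs
  imports "HOL-Analysis.Analysis" "HOL-Library.Function_Algebras"
begin

instantiation "fun" :: (type, real_vector) real_vector
begin

definition scaleR_fun :: "real \<Rightarrow> ('a \<Rightarrow> 'b) \<Rightarrow> 'a \<Rightarrow> 'b"
  where "scaleR_fun c f = (\<lambda>i. c *\<^sub>R f i)"

instance
  by standard (auto simp: scaleR_fun_def fun_eq_iff scaleR_add_right scaleR_add_left)

end

(* Sequences are indexed from 0. The exponent ranges over 0 < p \<le> \<infinity>;
   p = 0 is a junk case. *)
definition lp_norm :: "ennreal \<Rightarrow> (nat \<Rightarrow> real) \<Rightarrow> ennreal"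
  where "lp_norm p x =
    (if p = \<infinity> then (SUP i. ennreal \<bar>x i\<bar>)
     else if summable (\<lambda>i. \<bar>x i\<bar> powr enn2real p)
     then ennreal ((\<Sum>i. \<bar>x i\<bar> powr enn2real p) powr (1 / enn2real p))
     else \<infinity>)"

definition lp_ball :: "ennreal \<Rightarrow> (nat \<Rightarrow> real) set"
  where "lp_ball p = {x. lp_norm p x \<le> 1}"

definition conj_exponent :: "ennreal \<Rightarrow> real"
  where "conj_exponent p = (if p = \<infinity> then 1 else enn2real p / (enn2real p - 1))"

definition absconv :: "'a::real_vector set \<Rightarrow> 'a set"
  where "absconv A = convex hull (A \<union> uminus ` A)"

(* The infimum of the empty set is \<infinity>, the value when no finite cover exists.
   For subsets of \<ell>_\<infinity> it is immaterial that the translation vectors range over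
   all sequences: a translate meeting K is by an element of \<ell>_\<infinity>, and the
   other translates can be dropped. *)
definition covering_number :: "'a::ab_group_add set \<Rightarrow> 'a set \<Rightarrow> enat"
  where "covering_number K L =
    Inf {enat (card T) | T. finite T \<and> K \<subseteq> (\<Union>t\<in>T. (+) t ` L)}"

end

theory Submission
  imports Defs
begin

text \<open>For \<open>\<epsilon> < 1\<close> put \<open>q = p / (p - 1)\<close> and \<open>k = \<lceil>1 / \<epsilon>\<^sup>q\<rceil>\<close>.

  If \<open>k \<le> m\<close>, Maurey's lemma replaces a point of the absolutely convex hull by an average of \<open>k\<close>
  of the points \<open>\<plusminus>x\<^sub>i\<close>, with squared error at most \<open>1/k\<close> in \<open>\<ell>\<^sub>2\<close>. Rounding the error towards zero
  to multiples of \<open>1/k\<close> gives an integer vector (over \<open>k\<close>) of \<open>\<ell>\<^sub>1\<close> norm at most \<open>k\<close>, that is, a sum of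
  \<open>k\<close> signed unit vectors, and it is supported on the at most \<open>4mk\<^sup>2\<close> coordinates where some \<open>x\<^sub>i\<close>
  reaches \<open>1/(2k)\<close>. The remainder \<open>w\<close> has \<open>\<parallel>w\<parallel>\<^sub>\<infinity> \<le> 1/k\<close> and \<open>\<parallel>w\<parallel>\<^sub>2\<^sup>2 \<le> 1/k\<close>, so
  \<open>\<parallel>w\<parallel>\<^sub>p\<^sup>p \<le> k\<^sup>1\<^sup>-\<^sup>p \<le> \<epsilon>\<^sup>p\<close>. There are at most \<open>m\<^sup>9\<^sup>k\<close> centres.

  If \<open>k > m\<close>, rounding the \<open>m\<close> coefficients to multiples of \<open>1/(mk)\<close> already gives
  an \<open>\<ell>\<^sub>2\<close> error at most \<open>1/k \<le> \<epsilon>\<close>, with \<open>(2mk + 1)\<^sup>m\<close> centres.\<close>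

section \<open>Evaluation of sums of sequences, and finite covers\<close>

lemma sum_fun_apply:
  fixes f :: "'a \<Rightarrow> 'b \<Rightarrow> 'c::comm_monoid_add"
  shows "(\<Sum>a\<in>A. f a) i = (\<Sum>a\<in>A. f a i)"
  by (induction A rule: infinite_finite_induct) auto

lemma sum_list_fun_apply:
  fixes fs :: "('b \<Rightarrow> 'c::monoid_add) list"
  shows "sum_list fs i = (\<Sum>f\<leftarrow>fs. f i)"
  by (induction fs) auto

lemma scaleR_fun_apply [simp]: "(c *\<^sub>R f) i = c *\<^sub>R f i"
  by (simp add: scaleR_fun_def)

text \<open>An explicit cover bounds the infimum from above. \<open>M\<close> is kept apart from
  \<open>card T\<close> so that counting estimates can be inserted before logarithms are
  taken.\<close>

lemma covering_number_finite_cover: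
  assumes "finite T" "K \<subseteq> (\<Union>t\<in>T. (+) t ` L)" "card T \<le> M" "1 \<le> M"
  shows "covering_number K L \<noteq> \<infinity>"
    and "ln (real (the_enat (covering_number K L))) \<le> ln (real M)"
proof -
  have "covering_number K L \<le> enat (card T)"
    unfolding covering_number_def using assms by (intro Inf_lower) auto
  also have "\<dots> \<le> enat M"
    using assms by simp
  finally have le: "covering_number K L \<le> enat M" .
  then obtain n where n: "covering_number K L = enat n" "n \<le> M"
    by (cases "covering_number K L") auto
  then show "covering_number K L \<noteq> \<infinity>"
    by simp
  \<comment> \<open>The value \<open>n = 0\<close> occurs for empty \<open>K\<close>; then
    \<open>ln 0 = 0\<close>, and \<open>1 \<le> M\<close> makes the right side nonnegative.\<close>
  show "ln (real (the_enat (covering_number K L))) \<le> ln (real M)"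
    using n assms(4) by (cases "n = 0") auto
qed

section \<open>Membership in the balls of l_p\<close>

lemma ennreal_ge_2_cases:
  fixes p :: ennreal
  assumes "2 \<le> p"
  obtains "p = \<infinity>" | r where "p = ennreal r" "2 \<le> r"
proof (cases p)
  case (real r)
  then have "ennreal 2 \<le> ennreal r"
    using assms by (metis ennreal_numeral)
  then have "2 \<le> r"
    using real by (subst (asm) ennreal_le_iff) auto
  with real that show ?thesis
    by auto
next
  case top
  with that show ?thesis by simp
qed

text \<open>Lets later l_2 estimates work with real series of squares; the square root disappears
  because the radius is 1.\<close>

lemma lp_ball_2_iff:
  "f \<in> lp_ball 2 \<longleftrightarrow> summable (\<lambda>i. (f i)\<^sup>2) \<and> (\<Sum>i. (f i)\<^sup>2) \<le> 1"
proof -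
  have sq: "\<bar>f i\<bar> powr 2 = (f i)\<^sup>2" for i
    by (cases "f i = 0") (simp_all)
  have "0 \<le> (\<Sum>i. (f i)\<^sup>2)" if "summable (\<lambda>i. (f i)\<^sup>2)"
    using that by (intro suminf_nonneg) auto
  then show ?thesis
    by (auto simp: lp_ball_def lp_norm_def sq powr_half_sqrt top_unique)
qed

text \<open>Interpolation between the square norm and the supremum norm:
  \<open>\<bar>t\<bar>\<^sup>p \<le> \<eta>\<^sup>p\<^sup>-\<^sup>2 t\<^sup>2\<close> whenever \<open>\<bar>t\<bar> \<le> \<eta>\<close>.\<close>
lemma mem_scaled_lp_ball:
  fixes z :: "nat \<Rightarrow> real"
  assumes p: "2 \<le> p" and \<epsilon>: "0 < \<epsilon>"
    and summ: "summable (\<lambda>i. (z i)\<^sup>2)" and D: "(\<Sum>i. (z i)\<^sup>2) \<le> D"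
    and \<eta>: "\<And>i. \<bar>z i\<bar> \<le> \<eta>"
    and inf: "p = \<infinity> \<Longrightarrow> \<eta> \<le> \<epsilon>"
    and fin: "\<And>r. p = ennreal r \<Longrightarrow> 2 \<le> r \<Longrightarrow> \<eta> powr (r - 2) * D \<le> \<epsilon> powr r"
  shows "z \<in> (*\<^sub>R) \<epsilon> ` lp_ball p"
proof -
  define y where "y = (1 / \<epsilon>) *\<^sub>R z"
  have zy: "z = \<epsilon> *\<^sub>R y"
    using \<epsilon> by (simp add: y_def)
  from p have "y \<in> lp_ball p"
  proof (cases rule: ennreal_ge_2_cases)
    case 1
    have "\<bar>y i\<bar> \<le> 1" for i
      using order_trans[OF \<eta>[of i] inf[OF 1]] \<epsilon> by (simp add: y_def abs_mult field_simps)
    then have "(SUP i. ennreal \<bar>y i\<bar>) \<le> 1"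
      by (intro SUP_least) simp
    then show ?thesis
      by (simp add: lp_ball_def lp_norm_def 1)
  next
    case (2 r)
    have \<eta>0: "0 \<le> \<eta>"
      using \<eta>[of 0] by linarith
    have pt: "\<bar>y i\<bar> powr r \<le> \<eta> powr (r - 2) / \<epsilon> powr r * (z i)\<^sup>2" for i
    proof (cases "z i = 0")
      case True
      then show ?thesis using 2 by (simp add: y_def)
    next
      case False
      have "\<bar>z i\<bar> powr r = \<bar>z i\<bar> powr (r - 2) * \<bar>z i\<bar> powr 2"
        using False by (simp flip: powr_add del: powr_numeral)
      also have "\<dots> = \<bar>z i\<bar> powr (r - 2) * (z i)\<^sup>2"
        using False by simp
      also have "\<dots> \<le> \<eta> powr (r - 2) * (z i)\<^sup>2"
        using \<eta>[of i] False 2 by (intro mult_mono powr_mono2) auto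
      finally have "\<bar>z i\<bar> powr r \<le> \<eta> powr (r - 2) * (z i)\<^sup>2" .
      moreover have "\<bar>y i\<bar> powr r = \<bar>z i\<bar> powr r / \<epsilon> powr r"
        using \<epsilon> by (simp add: y_def abs_mult powr_divide)
      ultimately show ?thesis
        using \<epsilon> by (simp add: divide_right_mono)
    qed
    have sm: "summable (\<lambda>i. \<eta> powr (r - 2) / \<epsilon> powr r * (z i)\<^sup>2)"
      using summ by (rule summable_mult)
    have sy: "summable (\<lambda>i. \<bar>y i\<bar> powr r)"
      by (rule summable_comparison_test[OF _ sm]) (use pt in auto)
    have "(\<Sum>i. \<bar>y i\<bar> powr r) \<le> (\<Sum>i. \<eta> powr (r - 2) / \<epsilon> powr r * (z i)\<^sup>2)"
      by (rule suminf_le[OF pt sy sm])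
    also have "\<dots> = \<eta> powr (r - 2) / \<epsilon> powr r * (\<Sum>i. (z i)\<^sup>2)"
      by (rule suminf_mult[OF summ])
    also have "\<dots> \<le> \<eta> powr (r - 2) / \<epsilon> powr r * D"
      using D by (intro mult_left_mono) auto
    also have "\<dots> \<le> 1"
      using fin[OF 2] \<epsilon> by (simp add: divide_simps)
    finally have "(\<Sum>i. \<bar>y i\<bar> powr r) \<le> 1" .
    moreover have "0 \<le> (\<Sum>i. \<bar>y i\<bar> powr r)"
      by (rule suminf_nonneg[OF sy]) auto
    ultimately have "(\<Sum>i. \<bar>y i\<bar> powr r) powr (1 / r) \<le> 1"
      using 2 powr_mono2[of "1 / r" "\<Sum>i. \<bar>y i\<bar> powr r" 1] by simp
    then show ?thesis
      using sy 2 by (simp add: lp_ball_def lp_norm_def)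
  qed
  then show ?thesis
    using zy by blast
qed

lemma abs_le_of_sq_suminf_le:
  fixes z :: "nat \<Rightarrow> real"
  assumes "summable (\<lambda>i. (z i)\<^sup>2)" "(\<Sum>i. (z i)\<^sup>2) \<le> c\<^sup>2" "0 \<le> c"
  shows "\<bar>z i\<bar> \<le> c"
proof -
  have "(z i)\<^sup>2 \<le> (\<Sum>i. (z i)\<^sup>2)"
    using sum_le_suminf[OF assms(1), of "{i}"] by simp
  also have "\<dots> \<le> c\<^sup>2"
    by (rule assms(2))
  finally show ?thesis
    using assms(3) by (simp add: abs_le_square_iff[symmetric])
qed

text \<open>The l_2 norm dominates the l_p norm for \<open>2 \<le> p\<close>: interpolation with
  \<open>\<eta> = \<epsilon>\<close> and \<open>D = \<epsilon>\<^sup>2\<close>.\<close>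

lemma scaled_l2_ball_subset_lp_ball:
  fixes z :: "nat \<Rightarrow> real"
  assumes "2 \<le> p" "0 < \<epsilon>" "summable (\<lambda>i. (z i)\<^sup>2)" "(\<Sum>i. (z i)\<^sup>2) \<le> \<epsilon>\<^sup>2"
  shows "z \<in> (*\<^sub>R) \<epsilon> ` lp_ball p"
proof (rule mem_scaled_lp_ball[OF assms])
  show "\<bar>z i\<bar> \<le> \<epsilon>" for i
    using abs_le_of_sq_suminf_le[OF assms(3,4)] assms(2) by simp
  show "\<epsilon> powr (r - 2) * \<epsilon>\<^sup>2 \<le> \<epsilon> powr r" if "2 \<le> r" for r
  proof -
    have "\<epsilon>\<^sup>2 = \<epsilon> powr 2"
      using assms(2) by simp
    then show ?thesis
      by (simp flip: powr_add)
  qed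
qed auto

section \<open>The unit ball of l_2 and Maurey's lemma\<close>

lemma summable_sq_add:
  fixes f g :: "nat \<Rightarrow> real"
  assumes "summable (\<lambda>i. (f i)\<^sup>2)" "summable (\<lambda>i. (g i)\<^sup>2)"
  shows "summable (\<lambda>i. (f i + g i)\<^sup>2)"
proof (rule summable_comparison_test)
  show "summable (\<lambda>i. 2 * (f i)\<^sup>2 + 2 * (g i)\<^sup>2)"
    using assms by (intro summable_add summable_mult)
  have "(a + b)\<^sup>2 \<le> 2 * a\<^sup>2 + 2 * b\<^sup>2" for a b :: real
    using zero_le_power2[of "a - b"] by (simp add: power2_eq_square algebra_simps)
  then show "\<exists>N. \<forall>n\<ge>N. norm ((f n + g n)\<^sup>2) \<le> 2 * (f n)\<^sup>2 + 2 * (g n)\<^sup>2"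
    by simp
qed

lemma summable_sq_diff:
  fixes f g :: "nat \<Rightarrow> real"
  assumes "summable (\<lambda>i. (f i)\<^sup>2)" "summable (\<lambda>i. (g i)\<^sup>2)"
  shows "summable (\<lambda>i. (f i - g i)\<^sup>2)"
  using summable_sq_add[of f "\<lambda>i. - g i"] assms by simp

text \<open>Reduces to convexity of the square in each coordinate: for \<open>a + b = 1\<close> the
  defect is exactly \<open>a * b * (f i - g i)\<^sup>2\<close>.\<close>

lemma convex_lp_ball_2: "convex (lp_ball 2)"
  unfolding convex_def
proof (intro ballI allI impI)
  fix f g :: "nat \<Rightarrow> real" and a b :: real
  assume fg: "f \<in> lp_ball 2" "g \<in> lp_ball 2" and ab: "0 \<le> a" "0 \<le> b" "a + b = 1"
  have pt: "((a *\<^sub>R f + b *\<^sub>R g) i)\<^sup>2 \<le> a * (f i)\<^sup>2 + b * (g i)\<^sup>2" for i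
  proof -
    have b: "b = 1 - a"
      using ab(3) by simp
    have "a * (f i)\<^sup>2 + b * (g i)\<^sup>2 - (a * f i + b * g i)\<^sup>2 = a * b * (f i - g i)\<^sup>2"
      unfolding b by (simp add: power2_eq_square algebra_simps)
    moreover have "0 \<le> a * b * (f i - g i)\<^sup>2"
      using ab by simp
    ultimately show ?thesis by simp
  qed
  have sm: "summable (\<lambda>i. a * (f i)\<^sup>2)" "summable (\<lambda>i. b * (g i)\<^sup>2)"
    using fg by (auto simp: lp_ball_2_iff)
  have s: "summable (\<lambda>i. ((a *\<^sub>R f + b *\<^sub>R g) i)\<^sup>2)"
    by (rule summable_comparison_test[OF _ summable_add[OF sm]]) (use pt in auto)
  have "(\<Sum>i. ((a *\<^sub>R f + b *\<^sub>R g) i)\<^sup>2) \<le> (\<Sum>i. a * (f i)\<^sup>2 + b * (g i)\<^sup>2)"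
    by (rule suminf_le[OF pt s summable_add[OF sm]])
  also have "\<dots> = a * (\<Sum>i. (f i)\<^sup>2) + b * (\<Sum>i. (g i)\<^sup>2)"
    using fg by (simp add: suminf_add[OF sm, symmetric] suminf_mult lp_ball_2_iff)
  also have "\<dots> \<le> a * 1 + b * 1"
    using fg ab by (intro add_mono mult_left_mono) (auto simp: lp_ball_2_iff)
  finally show "a *\<^sub>R f + b *\<^sub>R g \<in> lp_ball 2"
    using s ab by (simp add: lp_ball_2_iff)
qed

lemma absconv_subset_lp_ball_2:
  assumes "X \<subseteq> lp_ball 2"
  shows "absconv X \<subseteq> lp_ball 2"
  unfolding absconv_def
  by (rule hull_minimal) (use assms convex_lp_ball_2 in \<open>auto simp: lp_ball_2_iff\<close>)

text \<open>Derandomised Maurey lemma: averaging the square norm of \<open>S + u - y\<close> over the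
  convex combination representing \<open>y\<close> shows that some \<open>u\<close> raises it by at most 1.\<close>
lemma maurey_step:
  fixes S y :: "nat \<Rightarrow> real"
  assumes A: "finite A" "A \<subseteq> lp_ball 2" and y: "y \<in> convex hull A"
    and S: "summable (\<lambda>i. (S i)\<^sup>2)"
  obtains u where "u \<in> A" "summable (\<lambda>i. (S i + u i - y i)\<^sup>2)"
    "(\<Sum>i. (S i + u i - y i)\<^sup>2) \<le> (\<Sum>i. (S i)\<^sup>2) + 1"
proof -
  obtain c where c: "\<And>u. u \<in> A \<Longrightarrow> 0 \<le> c u" "sum c A = 1" "(\<Sum>u\<in>A. c u *\<^sub>R u) = y"
    using y A(1) by (auto simp: convex_hull_finite)
  have yi: "(\<Sum>u\<in>A. c u * u i) = y i" for i
    using fun_cong[OF c(3), of i] by (simp add: sum_fun_apply)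
  have "y \<in> lp_ball 2"
    using hull_minimal[of A "lp_ball 2" convex] A(2) convex_lp_ball_2 y by blast
  then have sm: "summable (\<lambda>i. (S i + u i - y i)\<^sup>2)" if "u \<in> A" for u
    using that A S by (intro summable_sq_diff summable_sq_add) (auto simp: lp_ball_2_iff)
  have su: "summable (\<lambda>i. (u i)\<^sup>2)" "(\<Sum>i. (u i)\<^sup>2) \<le> 1" if "u \<in> A" for u
    using that A by (auto simp: lp_ball_2_iff)
  have pt: "(\<Sum>u\<in>A. c u * (S i + u i - y i)\<^sup>2) \<le> (S i)\<^sup>2 + (\<Sum>u\<in>A. c u * (u i)\<^sup>2)" for i
  proof -
    have "(\<Sum>u\<in>A. c u * (S i + u i - y i)\<^sup>2) =
        (\<Sum>u\<in>A. c u * (S i - y i)\<^sup>2 + 2 * (S i - y i) * (c u * u i) + c u * (u i)\<^sup>2)"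
      by (intro sum.cong) (auto simp: power2_eq_square algebra_simps)
    also have "\<dots> = (S i - y i)\<^sup>2 + 2 * (S i - y i) * y i + (\<Sum>u\<in>A. c u * (u i)\<^sup>2)"
      by (simp add: sum.distrib yi c(2) flip: sum_distrib_left sum_distrib_right)
    \<comment> \<open>The first two terms add up to \<open>(S i)\<^sup>2 - (y i)\<^sup>2\<close>:
      the weighted mean of the \<open>u i\<close> is \<open>y i\<close>, so no cross term with
      \<open>S\<close> survives.\<close>
    also have "\<dots> \<le> (S i)\<^sup>2 + (\<Sum>u\<in>A. c u * (u i)\<^sup>2)"
      by (simp add: power2_eq_square algebra_simps)
    finally show ?thesis .
  qed
  have "(\<Sum>u\<in>A. c u * (\<Sum>i. (S i + u i - y i)\<^sup>2)) = (\<Sum>i. \<Sum>u\<in>A. c u * (S i + u i - y i)\<^sup>2)"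
    using sm by (simp add: suminf_sum suminf_mult)
  also have "\<dots> \<le> (\<Sum>i. (S i)\<^sup>2 + (\<Sum>u\<in>A. c u * (u i)\<^sup>2))"
    using sm su S by (intro suminf_le pt summable_add summable_sum summable_mult) auto
  also have "\<dots> = (\<Sum>i. (S i)\<^sup>2) + (\<Sum>u\<in>A. c u * (\<Sum>i. (u i)\<^sup>2))"
    using su S by (subst suminf_add[symmetric])
      (auto simp: suminf_sum suminf_mult intro!: summable_sum summable_mult)
  also have "\<dots> \<le> (\<Sum>i. (S i)\<^sup>2) + (\<Sum>u\<in>A. c u * 1)"
    using c su by (intro add_left_mono sum_mono mult_left_mono) auto
  also have "\<dots> = (\<Sum>u\<in>A. c u * ((\<Sum>i. (S i)\<^sup>2) + 1))"
    by (simp add: c(2) flip: sum_distrib_right)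
  finally have avg: "(\<Sum>u\<in>A. c u * (\<Sum>i. (S i + u i - y i)\<^sup>2)) \<le>
    (\<Sum>u\<in>A. c u * ((\<Sum>i. (S i)\<^sup>2) + 1))" .
  have "\<exists>u\<in>A. (\<Sum>i. (S i + u i - y i)\<^sup>2) \<le> (\<Sum>i. (S i)\<^sup>2) + 1"
  proof (rule ccontr)
    assume "\<not> ?thesis"
    then have gt: "(\<Sum>i. (S i)\<^sup>2) + 1 < (\<Sum>i. (S i + u i - y i)\<^sup>2)" if "u \<in> A" for u
      using that by force
    \<comment> \<open>Weights may vanish, so a strict inequality between the averages needs one
      positive weight.\<close>
    obtain u where u: "u \<in> A" "c u > 0"
    proof (rule ccontr)
      assume "\<not> thesis"
      then have "c u \<le> 0" if "u \<in> A" for u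
        using that \<open>\<And>u. u \<in> A \<Longrightarrow> 0 < c u \<Longrightarrow> thesis\<close> by force
      then have "sum c A \<le> 0"
        by (rule sum_nonpos)
      then show False using c by simp
    qed
    have "(\<Sum>u\<in>A. c u * ((\<Sum>i. (S i)\<^sup>2) + 1)) < (\<Sum>u\<in>A. c u * (\<Sum>i. (S i + u i - y i)\<^sup>2))"
    proof (rule sum_strict_mono_ex1[OF A(1)])
      show "\<forall>u\<in>A. c u * ((\<Sum>i. (S i)\<^sup>2) + 1) \<le> c u * (\<Sum>i. (S i + u i - y i)\<^sup>2)"
        using c gt by (intro ballI mult_left_mono) (auto intro: less_imp_le)
      show "\<exists>u\<in>A. c u * ((\<Sum>i. (S i)\<^sup>2) + 1) < c u * (\<Sum>i. (S i + u i - y i)\<^sup>2)"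
        using u gt by (intro bexI[of _ u] mult_strict_left_mono)
    qed
    with avg show False by simp
  qed
  with sm that show thesis by blast
qed

text \<open>Greedy iteration of the single step, with \<open>S\<close> the error accumulated so far.
  Keeping the sum undivided makes each step cost at most 1; division by \<open>k\<close> then gives
  an average with squared error at most \<open>1 / k\<close>.\<close>

lemma maurey:
  fixes y :: "nat \<Rightarrow> real"
  assumes A: "finite A" "A \<subseteq> lp_ball 2" and y: "y \<in> convex hull A"
  shows "\<exists>us. set us \<subseteq> A \<and> length us = k \<and>
    summable (\<lambda>i. (sum_list us i - real k * y i)\<^sup>2) \<and>
    (\<Sum>i. (sum_list us i - real k * y i)\<^sup>2) \<le> real k"
proof (induction k)
  case 0
  show ?case by simp
next
  case (Suc k)
  then obtain us where us: "set us \<subseteq> A" "length us = k"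
    "summable (\<lambda>i. (sum_list us i - real k * y i)\<^sup>2)"
    "(\<Sum>i. (sum_list us i - real k * y i)\<^sup>2) \<le> real k"
    by blast
  obtain u where u: "u \<in> A"
    "summable (\<lambda>i. (sum_list us i - real k * y i + u i - y i)\<^sup>2)"
    "(\<Sum>i. (sum_list us i - real k * y i + u i - y i)\<^sup>2) \<le>
      (\<Sum>i. (sum_list us i - real k * y i)\<^sup>2) + 1"
    using maurey_step[OF A y us(3)] by blast
  have eq: "sum_list (u # us) i - real (Suc k) * y i =
      sum_list us i - real k * y i + u i - y i" for i
    by (simp add: algebra_simps)
  show ?case
    using us u by (intro exI[of _ "u # us"]) (simp only: eq, simp)
qed

section \<open>Large coordinates, signed unit vectors and integer rounding\<close>

text \<open>Chebyshev's counting argument: each such coordinate uses up \<open>c\<^sup>2\<close> of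
  a total of at most 1. Counting finite subsets first yields finiteness as well.\<close>

lemma card_large_coordinates:
  fixes f :: "nat \<Rightarrow> real"
  assumes f: "f \<in> lp_ball 2" and c: "0 < c" and n: "1 / c\<^sup>2 \<le> real n"
  shows "finite {j. c \<le> \<bar>f j\<bar>}" "card {j. c \<le> \<bar>f j\<bar>} \<le> n"
proof -
  have bd: "card F \<le> n" if F: "finite F" "F \<subseteq> {j. c \<le> \<bar>f j\<bar>}" for F
  proof -
    have "real (card F) * c\<^sup>2 = (\<Sum>j\<in>F. c\<^sup>2)"
      by simp
    also have "\<dots> \<le> (\<Sum>j\<in>F. (f j)\<^sup>2)"
      using F c by (intro sum_mono) (auto simp: abs_le_square_iff[symmetric])
    also have "\<dots> \<le> (\<Sum>j. (f j)\<^sup>2)"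
      using f F by (intro sum_le_suminf) (auto simp: lp_ball_2_iff)
    also have "\<dots> \<le> 1"
      using f by (simp add: lp_ball_2_iff)
    finally have "real (card F) \<le> 1 / c\<^sup>2"
      using c by (simp add: field_simps)
    with n show ?thesis by linarith
  qed
  show "finite {j. c \<le> \<bar>f j\<bar>}" "card {j. c \<le> \<bar>f j\<bar>} \<le> n"
    using finite_if_finite_subsets_card_bdd[of "{j. c \<le> \<bar>f j\<bar>}" n] bd by auto
qed

text \<open>Zero is included as padding, so that shorter sums of signed unit vectors can be brought
  to a prescribed length.\<close>

definition signed_units :: "nat set \<Rightarrow> (nat \<Rightarrow> real) set"
  where "signed_units J = insert 0 ((\<lambda>(j, s) i. if i = j then s else 0) ` (J \<times> {1, -1}))"

lemma signed_units:
  assumes "finite J"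
  shows "finite (signed_units J)" "card (signed_units J) \<le> 2 * card J + 1"
proof -
  let ?f = "\<lambda>(j, s) i::nat. if i = j then s else (0::real)"
  show "finite (signed_units J)"
    using assms by (simp add: signed_units_def)
  have "card (signed_units J) \<le> Suc (card (?f ` (J \<times> {1, -1})))"
    unfolding signed_units_def by (rule card_insert_le_m1) auto
  also have "card (?f ` (J \<times> {1, -1})) \<le> card (J \<times> {1, -1 :: real})"
    using assms by (intro card_image_le) auto
  also have "\<dots> = 2 * card J"
    by (simp add: card_cartesian_product)
  finally show "card (signed_units J) \<le> 2 * card J + 1"
    by simp
qed

text \<open>Induction on \<open>k\<close>: moving one nonzero entry a unit towards zero splits off a
  signed unit vector and lowers the l_1 norm by 1. Once the vector is zero, the list is
  padded.\<close>

lemma integer_vector_sum_list: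
  fixes v :: "nat \<Rightarrow> int"
  assumes "finite J" "\<And>j. j \<notin> J \<Longrightarrow> v j = 0" "(\<Sum>j\<in>J. \<bar>v j\<bar>) \<le> int k"
  shows "\<exists>vs. set vs \<subseteq> signed_units J \<and> length vs = k \<and> sum_list vs = (\<lambda>j. real_of_int (v j))"
  using assms(2,3)
proof (induction k arbitrary: v)
  case 0
  then have "(\<Sum>j\<in>J. \<bar>v j\<bar>) = 0"
    by (intro antisym sum_nonneg) auto
  then have "\<forall>j\<in>J. v j = 0"
    using assms(1) by (subst (asm) sum_nonneg_eq_0_iff) auto
  with 0 have "v j = 0" for j
    by blast
  then show ?case by (auto simp: zero_fun_def)
next
  case (Suc k)
  show ?case
  proof (cases "\<exists>j. v j \<noteq> 0")
    case False
    with Suc.IH[of v] obtain vs where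
      "set vs \<subseteq> signed_units J" "length vs = k" "sum_list vs = (\<lambda>j. real_of_int (v j))"
      by auto
    then show ?thesis
      by (intro exI[of _ "0 # vs"]) (auto simp: signed_units_def)
  next
    case True
    then obtain j0 where j0: "v j0 \<noteq> 0" by blast
    with Suc.prems have j0J: "j0 \<in> J" by blast
    define w where "w = v(j0 := v j0 - sgn (v j0))"
    have "(\<Sum>j\<in>J. \<bar>w j\<bar>) = (\<Sum>j\<in>J - {j0}. \<bar>v j\<bar>) + \<bar>v j0 - sgn (v j0)\<bar>"
      using assms(1) j0J by (subst sum.remove[of _ j0]) (auto simp: w_def)
    also have "\<bar>v j0 - sgn (v j0)\<bar> = \<bar>v j0\<bar> - 1"
      using j0 by (auto simp: sgn_if)
    also have "(\<Sum>j\<in>J - {j0}. \<bar>v j\<bar>) = (\<Sum>j\<in>J. \<bar>v j\<bar>) - \<bar>v j0\<bar>"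
      using assms(1) j0J by (subst (2) sum.remove[of _ j0]) auto
    finally have "(\<Sum>j\<in>J. \<bar>w j\<bar>) \<le> int k"
      using Suc.prems by simp
    moreover have "w j = 0" if "j \<notin> J" for j
      using that Suc.prems j0J by (auto simp: w_def)
    ultimately obtain vs where
      vs: "set vs \<subseteq> signed_units J" "length vs = k" "sum_list vs = (\<lambda>j. real_of_int (w j))"
      using Suc.IH[of w] by blast
    let ?e = "\<lambda>i. if i = j0 then real_of_int (sgn (v j0)) else 0"
    have "?e \<in> signed_units J"
      using j0 j0J unfolding signed_units_def
      by (intro insertI2 image_eqI[of _ _ "(j0, real_of_int (sgn (v j0)))"]) (auto simp: sgn_if)
    then show ?thesis
      using vs by (intro exI[of _ "?e # vs"]) (auto simp: w_def fun_eq_iff)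
  qed
qed

text \<open>Rounding towards zero keeps the square norm of the remainder under control.\<close>
lemma round_towards_zero:
  obtains v :: int where "\<bar>t - real_of_int v\<bar> \<le> 1" "\<bar>t - real_of_int v\<bar> \<le> \<bar>t\<bar>"
    "\<bar>real_of_int v\<bar> \<le> \<bar>t\<bar>" "\<bar>t\<bar> < 1 \<Longrightarrow> v = 0"
proof (cases "0 \<le> t")
  case True
  have "0 \<le> \<lfloor>t\<rfloor>" "real_of_int \<lfloor>t\<rfloor> \<le> t" "t < real_of_int \<lfloor>t\<rfloor> + 1"
    using True by linarith+
  then show ?thesis
    using True by (intro that[of "\<lfloor>t\<rfloor>"]) linarith+
next
  case False
  have "\<lceil>t\<rceil> \<le> 0" "t \<le> real_of_int \<lceil>t\<rceil>" "real_of_int \<lceil>t\<rceil> < t + 1"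
    using False by linarith+
  then show ?thesis
    using False by (intro that[of "\<lceil>t\<rceil>"]) linarith+
qed

text \<open>Integers satisfy \<open>\<bar>n\<bar> \<le> n\<^sup>2\<close>, so after rounding towards
  zero the l_2 bound on \<open>z\<close> becomes an l_1 bound on an integer vector. That vector
  vanishes outside \<open>J\<close>.\<close>

lemma sparse_rounding:
  fixes z :: "nat \<Rightarrow> real"
  assumes z: "summable (\<lambda>i. (z i)\<^sup>2)" "(\<Sum>i. (z i)\<^sup>2) \<le> real k"
    and J: "finite J" "\<And>j. j \<notin> J \<Longrightarrow> \<bar>z j\<bar> < 1"
  obtains vs where "set vs \<subseteq> signed_units J" "length vs = k"
    "\<And>i. \<bar>z i - sum_list vs i\<bar> \<le> 1" "\<And>i. \<bar>z i - sum_list vs i\<bar> \<le> \<bar>z i\<bar>"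
proof -
  have "\<exists>v::int. \<bar>z i - real_of_int v\<bar> \<le> 1 \<and> \<bar>z i - real_of_int v\<bar> \<le> \<bar>z i\<bar> \<and>
    \<bar>real_of_int v\<bar> \<le> \<bar>z i\<bar> \<and> (\<bar>z i\<bar> < 1 \<longrightarrow> v = 0)" for i
    by (metis round_towards_zero)
  then obtain v :: "nat \<Rightarrow> int" where v: "\<And>i. \<bar>z i - real_of_int (v i)\<bar> \<le> 1"
    "\<And>i. \<bar>z i - real_of_int (v i)\<bar> \<le> \<bar>z i\<bar>"
    "\<And>i. \<bar>real_of_int (v i)\<bar> \<le> \<bar>z i\<bar>" "\<And>i. \<bar>z i\<bar> < 1 \<Longrightarrow> v i = 0"
    by metis
  have abs_le_sq: "\<bar>n\<bar> \<le> n\<^sup>2" for n :: int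
    using self_le_power[of "\<bar>n\<bar>" 2] by (cases "n = 0") auto
  have "real_of_int (\<Sum>j\<in>J. \<bar>v j\<bar>) \<le> (\<Sum>j\<in>J. (z j)\<^sup>2)"
    unfolding of_int_sum
  proof (rule sum_mono)
    fix j
    have "real_of_int \<bar>v j\<bar> \<le> (real_of_int (v j))\<^sup>2"
      using abs_le_sq[of "v j"] by (simp flip: of_int_power)
    also have "\<dots> \<le> (z j)\<^sup>2"
      using v(3)[of j] by (simp add: abs_le_square_iff)
    finally show "real_of_int \<bar>v j\<bar> \<le> (z j)\<^sup>2" .
  qed
  also have "\<dots> \<le> (\<Sum>j. (z j)\<^sup>2)"
    using J z by (intro sum_le_suminf) auto
  also have "\<dots> \<le> real k"
    by (rule z)
  finally have "(\<Sum>j\<in>J. \<bar>v j\<bar>) \<le> int k"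
    by linarith
  then obtain vs where "set vs \<subseteq> signed_units J" "length vs = k"
    "sum_list vs = (\<lambda>j. real_of_int (v j))"
    using integer_vector_sum_list[of J v k] J v(4) by blast
  with v(1,2) that show thesis by simp
qed

section \<open>Covering by corrected averages\<close>

text \<open>An open slab symmetric about the origin is convex, hence contains the hull. Strictness
  is kept because coordinates strictly below 1 are the ones rounded to 0.\<close>

lemma absconv_coordinate_less:
  fixes X :: "(nat \<Rightarrow> real) set"
  assumes "y \<in> absconv X" "\<And>u. u \<in> X \<Longrightarrow> \<bar>u j\<bar> < c"
  shows "\<bar>y j\<bar> < c"
proof -
  have "convex {f :: nat \<Rightarrow> real. \<bar>f j\<bar> < c}"
    unfolding convex_def
  proof (intro ballI allI impI, clarsimp)
    fix f g :: "nat \<Rightarrow> real" and a b :: real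
    assume *: "\<bar>f j\<bar> < c" "\<bar>g j\<bar> < c" "0 \<le> a" "0 \<le> b" "a + b = 1"
    have "\<bar>a * f j + b * g j\<bar> \<le> a * \<bar>f j\<bar> + b * \<bar>g j\<bar>"
      using abs_triangle_ineq[of "a * f j" "b * g j"] * by (simp add: abs_mult)
    also have "\<dots> < c"
      using * by (intro convex_bound_lt)
    finally show "\<bar>a * f j + b * g j\<bar> < c" .
  qed
  then have "absconv X \<subseteq> {f. \<bar>f j\<bar> < c}"
    unfolding absconv_def using assms(2) by (intro hull_minimal) auto
  with assms(1) show ?thesis by blast
qed

lemma abs_sum_list_apply_le:
  fixes us :: "(nat \<Rightarrow> real) list"
  assumes "\<And>u. u \<in> set us \<Longrightarrow> \<bar>u j\<bar> \<le> c"
  shows "\<bar>sum_list us j\<bar> \<le> real (length us) * c"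
  using assms
proof (induction us)
  case (Cons u us)
  then have "\<bar>u j\<bar> \<le> c" "\<bar>sum_list us j\<bar> \<le> real (length us) * c"
    by auto
  then show ?case by (simp add: algebra_simps)
qed simp

text \<open>A centre is a Maurey average \<open>us\<close> minus its rounded error
  \<open>vs\<close>, divided by \<open>k\<close>. The two factors of the count are the choices of
  \<open>us\<close> among the at most \<open>2 * m\<close> points of the symmetrised set and of
  \<open>vs\<close> among the signed units on at most \<open>4 * m * k\<^sup>2\<close> coordinates,
  plus zero.\<close>

lemma finite_cover_by_averages:
  fixes X :: "(nat \<Rightarrow> real) set"
  assumes X: "finite X" "card X \<le> m" "X \<subseteq> lp_ball 2"
    and k: "1 \<le> k" and p: "2 \<le> p" and \<epsilon>: "0 < \<epsilon>" "1 / real k \<le> \<epsilon> powr conj_exponent p"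
  shows "\<exists>T. finite T \<and> absconv X \<subseteq> (\<Union>t\<in>T. (+) t ` ((*\<^sub>R) \<epsilon> ` lp_ball p)) \<and>
    card T \<le> (2 * m) ^ k * (8 * m * k\<^sup>2 + 1) ^ k"
proof -
  define A where "A = X \<union> uminus ` X"
  \<comment> \<open>Chosen so that \<open>real k * c = 1 / 2\<close>: outside \<open>J\<close> both
    \<open>sum_list us\<close> and \<open>k\<close> times \<open>y\<close> are at most 1/2 in
    modulus, the latter strictly, so their difference stays below 1.\<close>
  define c where "c = 1 / (2 * real k)"
  \<comment> \<open>\<open>J\<close> depends on \<open>X\<close> alone, so one finite set of centres
    serves every \<open>y\<close>.\<close>
  define J where "J = (\<Union>u\<in>X. {j. c \<le> \<bar>u j\<bar>})"
  define V where "V = signed_units J"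
  define lists_in where "lists_in B = {us. set us \<subseteq> B \<and> length us = k}" for B :: "(nat \<Rightarrow> real) set"
  define center where "center = (\<lambda>(us, vs). (1 / real k) *\<^sub>R (sum_list us - sum_list vs :: nat \<Rightarrow> real))"
  define T where "T = center ` (lists_in A \<times> lists_in V)"
  have c0: "0 < c" and c2: "1 / c\<^sup>2 \<le> real (4 * k\<^sup>2)"
    using k by (auto simp: c_def power2_eq_square)
  have A: "finite A" "A \<subseteq> lp_ball 2"
    using X by (auto simp: A_def lp_ball_2_iff)
  have "card A \<le> card X + card (uminus ` X)"
    unfolding A_def by (rule card_Un_le)
  also have "\<dots> \<le> m + m"
    using X card_image_le[of X uminus] by linarith
  finally have cardA: "card A \<le> 2 * m" by simp
  have large: "finite {j. c \<le> \<bar>u j\<bar>}" "card {j. c \<le> \<bar>u j\<bar>} \<le> 4 * k\<^sup>2" if "u \<in> X" for u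
    using card_large_coordinates[of u c "4 * k\<^sup>2"] that X c0 c2 by auto
  have finJ: "finite J"
    using X large by (simp add: J_def)
  have "card J \<le> (\<Sum>u\<in>X. card {j. c \<le> \<bar>u j\<bar>})"
    unfolding J_def by (rule card_UN_le[OF X(1)])
  also have "\<dots> \<le> card X * (4 * k\<^sup>2)"
    using sum_bounded_above[of X "\<lambda>u. card {j. c \<le> \<bar>u j\<bar>}"] large by simp
  also have "\<dots> \<le> m * (4 * k\<^sup>2)"
    using X by (intro mult_right_mono) auto
  finally have V: "finite V" "card V \<le> 8 * m * k\<^sup>2 + 1"
    using signed_units[OF finJ] by (auto simp: V_def)
  have fin_lists: "finite (lists_in B)" "card (lists_in B) = card B ^ k" if "finite B" for B
    using that by (simp_all add: lists_in_def finite_lists_length_eq card_lists_length_eq)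
  have "card T \<le> card (lists_in A \<times> lists_in V)"
    unfolding T_def using A V fin_lists by (intro card_image_le) auto
  also have "\<dots> = card A ^ k * card V ^ k"
    using A V fin_lists by (simp add: card_cartesian_product)
  also have "\<dots> \<le> (2 * m) ^ k * (8 * m * k\<^sup>2 + 1) ^ k"
    using cardA V by (intro mult_mono power_mono) auto
  finally have cardT: "card T \<le> (2 * m) ^ k * (8 * m * k\<^sup>2 + 1) ^ k" .
  have finT: "finite T"
    unfolding T_def using A V fin_lists by auto
  have "absconv X \<subseteq> (\<Union>t\<in>T. (+) t ` ((*\<^sub>R) \<epsilon> ` lp_ball p))"
  proof
    fix y assume y: "y \<in> absconv X"
    obtain us where us: "set us \<subseteq> A" "length us = k"
      and z: "summable (\<lambda>i. (sum_list us i - real k * y i)\<^sup>2)"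
        "(\<Sum>i. (sum_list us i - real k * y i)\<^sup>2) \<le> real k"
      using maurey[OF A, of y k] y by (auto simp: absconv_def A_def)
    have small: "\<bar>sum_list us j - real k * y j\<bar> < 1" if j: "j \<notin> J" for j
    proof -
      have uj: "\<bar>u j\<bar> < c" if "u \<in> X" for u
        using that j by (force simp: J_def)
      have "\<bar>u j\<bar> \<le> c" if "u \<in> set us" for u
        using uj us(1) that by (force simp: A_def)
      then have "\<bar>sum_list us j\<bar> \<le> real k * c"
        using abs_sum_list_apply_le[of us j c] us(2) by simp
      moreover have "real k * \<bar>y j\<bar> < real k * c"
        using absconv_coordinate_less[OF y uj] k by simp
      moreover have "\<bar>sum_list us j - real k * y j\<bar> \<le> \<bar>sum_list us j\<bar> + real k * \<bar>y j\<bar>"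
        using abs_triangle_ineq4[of "sum_list us j" "real k * y j"] by (simp add: abs_mult)
      moreover have "real k * c = 1 / 2"
        using k by (simp add: c_def)
      ultimately show ?thesis by linarith
    qed
    obtain vs where vs: "set vs \<subseteq> V" "length vs = k"
      and w: "\<And>i. \<bar>sum_list us i - real k * y i - sum_list vs i\<bar> \<le> 1"
        "\<And>i. \<bar>sum_list us i - real k * y i - sum_list vs i\<bar> \<le> \<bar>sum_list us i - real k * y i\<bar>"
      using sparse_rounding[OF z finJ small] unfolding V_def by blast
    let ?t = "center (us, vs)"
    let ?w = "y - ?t"
    have weq: "?w i = - (sum_list us i - real k * y i - sum_list vs i) / real k" for i
      using k by (simp add: center_def field_simps)
    have pt: "(?w i)\<^sup>2 \<le> (1 / real k)\<^sup>2 * (sum_list us i - real k * y i)\<^sup>2" for i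
    proof -
      have "(sum_list us i - real k * y i - sum_list vs i)\<^sup>2 \<le> (sum_list us i - real k * y i)\<^sup>2"
        using w(2)[of i] by (simp add: abs_le_square_iff)
      then show ?thesis
        unfolding weq by (simp add: power_divide divide_right_mono power2_commute)
    qed
    have sz: "summable (\<lambda>i. (1 / real k)\<^sup>2 * (sum_list us i - real k * y i)\<^sup>2)"
      by (rule summable_mult[OF z(1)])
    have sw: "summable (\<lambda>i. (?w i)\<^sup>2)"
      by (rule summable_comparison_test[OF _ sz]) (use pt in auto)
    have "(\<Sum>i. (?w i)\<^sup>2) \<le> (\<Sum>i. (1 / real k)\<^sup>2 * (sum_list us i - real k * y i)\<^sup>2)"
      by (rule suminf_le[OF pt sw sz])
    also have "\<dots> = (1 / real k)\<^sup>2 * (\<Sum>i. (sum_list us i - real k * y i)\<^sup>2)"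
      by (rule suminf_mult[OF z(1)])
    also have "\<dots> \<le> (1 / real k)\<^sup>2 * real k"
      by (rule mult_left_mono[OF z(2)]) simp
    also have "\<dots> = 1 / real k"
      using k by (simp add: power2_eq_square)
    finally have D: "(\<Sum>i. (?w i)\<^sup>2) \<le> 1 / real k" .
    have "?w \<in> (*\<^sub>R) \<epsilon> ` lp_ball p"
    \<comment> \<open>Here \<open>\<eta> = D = 1 / k\<close>, which gives the power
      \<open>r - 1\<close> of \<open>1 / k\<close>; the conjugate exponent
      \<open>r / (r - 1)\<close> turns it into \<open>\<epsilon> powr r\<close>.\<close>
    proof (rule mem_scaled_lp_ball[OF p \<epsilon>(1) sw D])
      show "\<bar>?w i\<bar> \<le> 1 / real k" for i
        unfolding weq abs_divide abs_minus_cancel using w(1)[of i] k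
        by (simp add: divide_right_mono)
      show "1 / real k \<le> \<epsilon>" if "p = \<infinity>"
        using \<epsilon> that by (simp add: conj_exponent_def)
      show "(1 / real k) powr (r - 2) * (1 / real k) \<le> \<epsilon> powr r" if r: "p = ennreal r" "2 \<le> r" for r
      proof -
        have "(1 / real k) powr (r - 2) * (1 / real k) = (1 / real k) powr (r - 2) * (1 / real k) powr 1"
          using k by simp
        also have "\<dots> = (1 / real k) powr (r - 1)"
          by (subst powr_add[symmetric]) simp
        also have "\<dots> \<le> (\<epsilon> powr (r / (r - 1))) powr (r - 1)"
          using \<epsilon> r by (intro powr_mono2) (auto simp: conj_exponent_def)
        also have "\<dots> = \<epsilon> powr r"
          using r by (simp add: powr_powr)
        finally show ?thesis .
      qed
    qed
    moreover have "?t \<in> T"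
      using us vs by (auto simp: T_def lists_in_def)
    moreover have "y = ?t + ?w"
      by simp
    ultimately show "y \<in> (\<Union>t\<in>T. (+) t ` ((*\<^sub>R) \<epsilon> ` lp_ball p))"
      by blast
  qed
  with finT cardT show ?thesis by blast
qed

section \<open>Covering by a grid of coefficients\<close>

text \<open>The right side is convex and contains every \<open>x i\<close> and its negative.
  Coefficients are indexed by \<open>I\<close>, so repeated points cause no trouble.\<close>

lemma absconv_subset_bounded_combinations:
  fixes x :: "'i \<Rightarrow> nat \<Rightarrow> real"
  assumes "finite I"
  shows "absconv (x ` I) \<subseteq> {\<Sum>i\<in>I. a i *\<^sub>R x i | a. \<forall>i\<in>I. \<bar>a i\<bar> \<le> 1}" (is "_ \<subseteq> ?R")
  unfolding absconv_def
proof (rule hull_minimal)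
  have "s *\<^sub>R x i \<in> ?R" if "i \<in> I" "\<bar>s\<bar> \<le> 1" for i s
  proof -
    have "(\<Sum>l\<in>I. (if l = i then s else 0) *\<^sub>R x l) = s *\<^sub>R x i"
      using that assms by (simp add: if_distrib[of "\<lambda>c. c *\<^sub>R _"] cong: if_cong)
    moreover have "\<forall>l\<in>I. \<bar>if l = i then s else 0\<bar> \<le> 1"
      using that by auto
    ultimately show ?thesis
      by (intro CollectI exI[of _ "\<lambda>l. if l = i then s else 0"]) auto
  qed
  from this[of _ 1] this[of _ "- 1"] show "x ` I \<union> uminus ` x ` I \<subseteq> ?R"
    by (auto simp del: mem_Collect_eq)
  show "convex ?R"
    unfolding convex_def
  proof (intro ballI allI impI)
    fix f g :: "nat \<Rightarrow> real" and u v :: real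
    assume fg: "f \<in> ?R" "g \<in> ?R" and uv: "0 \<le> u" "0 \<le> v" "u + v = 1"
    obtain a b where a: "f = (\<Sum>i\<in>I. a i *\<^sub>R x i)" "\<forall>i\<in>I. \<bar>a i\<bar> \<le> 1"
      and b: "g = (\<Sum>i\<in>I. b i *\<^sub>R x i)" "\<forall>i\<in>I. \<bar>b i\<bar> \<le> 1"
      using fg by blast
    have "\<bar>u * a i + v * b i\<bar> \<le> 1" if "i \<in> I" for i
    proof -
      have "\<bar>u * a i + v * b i\<bar> \<le> u * \<bar>a i\<bar> + v * \<bar>b i\<bar>"
        using abs_triangle_ineq[of "u * a i" "v * b i"] uv by (simp add: abs_mult)
      also have "\<dots> \<le> 1"
        using a b uv that by (intro convex_bound_le) auto
      finally show ?thesis .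
    qed
    moreover have "u *\<^sub>R f + v *\<^sub>R g = (\<Sum>i\<in>I. (u * a i + v * b i) *\<^sub>R x i)"
      by (simp add: a(1) b(1) scaleR_sum_right scaleR_add_left sum.distrib)
    ultimately show "u *\<^sub>R f + v *\<^sub>R g \<in> ?R"
      by (intro CollectI exI[of _ "\<lambda>i. u * a i + v * b i"]) auto
  qed
qed

text \<open>Cauchy-Schwarz in each coordinate, then summation over coordinates. One factor
  \<open>card I\<close> comes from the coefficients, the other from the norms of the
  \<open>x i\<close>.\<close>

lemma small_combination_l2:
  fixes x :: "'i \<Rightarrow> nat \<Rightarrow> real"
  assumes x: "\<And>i. i \<in> I \<Longrightarrow> x i \<in> lp_ball 2" and r: "\<And>i. i \<in> I \<Longrightarrow> \<bar>r i\<bar> \<le> h"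
  shows "summable (\<lambda>j. ((\<Sum>i\<in>I. r i *\<^sub>R x i) j)\<^sup>2)"
    and "(\<Sum>j. ((\<Sum>i\<in>I. r i *\<^sub>R x i) j)\<^sup>2) \<le> (real (card I) * h)\<^sup>2"
proof -
  have pt: "((\<Sum>i\<in>I. r i *\<^sub>R x i) j)\<^sup>2 \<le> real (card I) * h\<^sup>2 * (\<Sum>i\<in>I. (x i j)\<^sup>2)" for j
  proof -
    have "((\<Sum>i\<in>I. r i *\<^sub>R x i) j)\<^sup>2 = (\<Sum>i\<in>I. r i * x i j)\<^sup>2"
      by (simp add: sum_fun_apply)
    also have "\<dots> \<le> (\<Sum>i\<in>I. (r i)\<^sup>2) * (\<Sum>i\<in>I. (x i j)\<^sup>2)"
      by (rule Cauchy_Schwarz_ineq_sum)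
    also have "\<dots> \<le> (\<Sum>i\<in>I. h\<^sup>2) * (\<Sum>i\<in>I. (x i j)\<^sup>2)"
      using r by (intro mult_right_mono sum_mono sum_nonneg) (auto simp flip: abs_le_square_iff intro: order_trans[OF _ abs_ge_self])
    finally show ?thesis by simp
  qed
  have sx: "summable (\<lambda>j. \<Sum>i\<in>I. (x i j)\<^sup>2)"
    using x by (intro summable_sum) (auto simp: lp_ball_2_iff)
  show sr: "summable (\<lambda>j. ((\<Sum>i\<in>I. r i *\<^sub>R x i) j)\<^sup>2)"
    by (rule summable_comparison_test[OF _ summable_mult[OF sx]]) (use pt in auto)
  have "(\<Sum>j. ((\<Sum>i\<in>I. r i *\<^sub>R x i) j)\<^sup>2) \<le> (\<Sum>j. real (card I) * h\<^sup>2 * (\<Sum>i\<in>I. (x i j)\<^sup>2))"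
    by (rule suminf_le[OF pt sr summable_mult[OF sx]])
  also have "\<dots> = real (card I) * h\<^sup>2 * (\<Sum>j. \<Sum>i\<in>I. (x i j)\<^sup>2)"
    by (rule suminf_mult[OF sx])
  also have "(\<Sum>j. \<Sum>i\<in>I. (x i j)\<^sup>2) = (\<Sum>i\<in>I. \<Sum>j. (x i j)\<^sup>2)"
    using x by (intro suminf_sum) (auto simp: lp_ball_2_iff)
  also have "real (card I) * h\<^sup>2 * \<dots> \<le> real (card I) * h\<^sup>2 * (\<Sum>i\<in>I. 1)"
    using x by (intro mult_left_mono sum_mono) (auto simp: lp_ball_2_iff)
  also have "\<dots> = (real (card I) * h)\<^sup>2"
    by (simp add: power2_eq_square)
  finally show "(\<Sum>j. ((\<Sum>i\<in>I. r i *\<^sub>R x i) j)\<^sup>2) \<le> (real (card I) * h)\<^sup>2" .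
qed

text \<open>Coefficients in [-1, 1] are rounded to multiples of \<open>1 / n\<close>, with
  \<open>2 * n + 1\<close> values each; rounding towards zero never leaves the interval. The l_2
  error is at most \<open>card I / n\<close>.\<close>

lemma finite_cover_by_coefficient_grid:
  fixes x :: "'i \<Rightarrow> nat \<Rightarrow> real"
  assumes I: "finite I" and x: "\<And>i. i \<in> I \<Longrightarrow> x i \<in> lp_ball 2"
    and p: "2 \<le> p" and \<epsilon>: "0 < \<epsilon>" and n: "1 \<le> n" "real (card I) / real n \<le> \<epsilon>"
  shows "\<exists>T. finite T \<and> absconv (x ` I) \<subseteq> (\<Union>t\<in>T. (+) t ` ((*\<^sub>R) \<epsilon> ` lp_ball p)) \<and>
    card T \<le> (2 * n + 1) ^ card I"
proof -
  define G where "G = I \<rightarrow>\<^sub>E {- int n..int n}"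
  define center where "center b = (\<Sum>i\<in>I. (real_of_int (b i) / real n) *\<^sub>R x i)" for b
  have G: "finite G" "card G = (2 * n + 1) ^ card I"
    using I by (auto simp: G_def card_PiE intro!: finite_PiE arg_cong2[where f = power])
  have "absconv (x ` I) \<subseteq> (\<Union>t\<in>center ` G. (+) t ` ((*\<^sub>R) \<epsilon> ` lp_ball p))"
  proof
    fix y assume "y \<in> absconv (x ` I)"
    then obtain a where y: "y = (\<Sum>i\<in>I. a i *\<^sub>R x i)" and a: "\<And>i. i \<in> I \<Longrightarrow> \<bar>a i\<bar> \<le> 1"
      using absconv_subset_bounded_combinations[OF I, of x] by blast
    have "\<exists>v::int. \<bar>real n * a i - real_of_int v\<bar> \<le> 1 \<and> \<bar>real_of_int v\<bar> \<le> \<bar>real n * a i\<bar>" for i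
      by (metis round_towards_zero)
    then obtain v :: "'i \<Rightarrow> int" where v: "\<And>i. \<bar>real n * a i - real_of_int (v i)\<bar> \<le> 1"
      "\<And>i. \<bar>real_of_int (v i)\<bar> \<le> \<bar>real n * a i\<bar>"
      by metis
    \<comment> \<open>Restriction makes the rounded coefficients extensional, as membership in
      \<open>G\<close> demands.\<close>
    define b where "b = restrict v I"
    have "v i \<in> {- int n..int n}" if "i \<in> I" for i
    proof -
      have "\<bar>real_of_int (v i)\<bar> \<le> real n"
        using v(2)[of i] mult_left_mono[OF a[OF that], of "real n"] by (simp add: abs_mult)
      then have "\<bar>v i\<bar> \<le> int n"
        by linarith
      then show ?thesis by auto
    qed
    then have bG: "b \<in> G"
      by (auto simp: b_def G_def)
    define r where "r i = a i - real_of_int (v i) / real n" for i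
    have r: "\<bar>r i\<bar> \<le> 1 / real n" for i
    proof -
      have "r i = (real n * a i - real_of_int (v i)) / real n"
        using n by (simp add: r_def field_simps)
      then show ?thesis
        using v(1)[of i] by (simp add: divide_right_mono)
    qed
    let ?w = "\<Sum>i\<in>I. r i *\<^sub>R x i"
    have "(\<Sum>j. (?w j)\<^sup>2) \<le> (real (card I) * (1 / real n))\<^sup>2"
      by (rule small_combination_l2(2)) (use x r in auto)
    also have "\<dots> \<le> \<epsilon>\<^sup>2"
      using n by (intro power_mono) auto
    finally have "(\<Sum>j. (?w j)\<^sup>2) \<le> \<epsilon>\<^sup>2" .
    moreover have "summable (\<lambda>j. (?w j)\<^sup>2)"
      by (rule small_combination_l2(1)[of I x r "1 / real n"]) (use x r in auto)
    ultimately have "?w \<in> (*\<^sub>R) \<epsilon> ` lp_ball p"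
      using scaled_l2_ball_subset_lp_ball[OF p \<epsilon>] by blast
    moreover have "y = center b + ?w"
      unfolding y center_def sum.distrib[symmetric]
      by (intro sum.cong) (auto simp: b_def r_def simp flip: scaleR_add_left)
    ultimately show "y \<in> (\<Union>t\<in>center ` G. (+) t ` ((*\<^sub>R) \<epsilon> ` lp_ball p))"
      using bG by blast
  qed
  moreover have "card (center ` G) \<le> (2 * n + 1) ^ card I"
    using card_image_le[of G center] G by simp
  ultimately show ?thesis
    using G(1) by (intro exI[of _ "center ` G"]) auto
qed

section \<open>Counting the centres and choosing \<open>k\<close>\<close>

lemma conj_exponent_ge_1:
  assumes "2 \<le> p"
  shows "1 \<le> conj_exponent p"
  using assms by (cases rule: ennreal_ge_2_cases) (auto simp: conj_exponent_def field_simps)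

text \<open>Constants are absorbed into powers of \<open>m\<close> using \<open>2 \<le> m\<close>:
  the first base is at most \<open>m\<^sup>2\<close>, the second at most 16 times the cube of
  \<open>m\<close>, hence at most \<open>m ^ 7\<close>.\<close>

lemma averages_count_le:
  fixes m k :: nat
  assumes "2 \<le> m" "k \<le> m"
  shows "(2 * m) ^ k * (8 * m * k\<^sup>2 + 1) ^ k \<le> m ^ (9 * k)"
proof -
  have 1: "2 * m \<le> m\<^sup>2"
    using assms by (simp add: power2_eq_square)
  have "8 * m * k\<^sup>2 + 1 \<le> 8 * m * m\<^sup>2 + 1"
    using assms by (intro add_mono mult_left_mono power_mono) auto
  also have "\<dots> \<le> 2 ^ 4 * m ^ 3"
    using assms one_le_power[of m 3] by (simp add: power2_eq_square power3_eq_cube)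
  also have "\<dots> \<le> m ^ 4 * m ^ 3"
    using assms by (intro mult_right_mono power_mono) auto
  finally have 2: "8 * m * k\<^sup>2 + 1 \<le> m ^ 7"
    by (simp flip: power_add)
  have "(2 * m) ^ k * (8 * m * k\<^sup>2 + 1) ^ k \<le> (m\<^sup>2) ^ k * (m ^ 7) ^ k"
    using 1 2 by (intro mult_mono power_mono) auto
  also have "\<dots> = m ^ (9 * k)"
    by (simp flip: power_mult power_add)
  finally show ?thesis .
qed

text \<open>The base is at most \<open>k ^ 4\<close>. Writing
  \<open>ln k = ln m + ln (k / m)\<close> gives \<open>m * ln k \<le> k * ln m + k\<close>, and
  \<open>k \<le> 2 * k * ln m\<close> since \<open>ln m \<ge> 1 / 2\<close>; hence 12 = 4 * (1 +
  2).\<close>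

lemma grid_log_count_le:
  fixes m k :: nat
  assumes "2 \<le> m" "m \<le> k"
  shows "ln (real ((2 * (m * k) + 1) ^ m)) \<le> 12 * real k * ln (real m)"
proof -
  have lnm: "1 / 2 \<le> ln (real m)"
    using ln2_ge_two_thirds ln_le_cancel_iff[of 2 "real m"] assms by linarith
  have "2 * (m * k) + 1 \<le> 2 * (k * k) + 1"
    using assms by simp
  also have "\<dots> \<le> 2\<^sup>2 * k\<^sup>2"
    using assms by (simp add: power2_eq_square)
  also have "\<dots> \<le> k\<^sup>2 * k\<^sup>2"
    using assms by (intro mult_right_mono power_mono) auto
  finally have "2 * (m * k) + 1 \<le> k ^ 4"
    by (simp flip: power_add)
  then have "real (2 * (m * k) + 1) \<le> real k ^ 4"
    by (metis of_nat_le_iff of_nat_power)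
  then have "ln (real (2 * (m * k) + 1)) \<le> ln (real k ^ 4)"
    using assms by (subst ln_le_cancel_iff) (auto intro: add_pos_nonneg)
  also have "\<dots> = 4 * ln (real k)"
    using assms by (simp add: ln_realpow)
  finally have "ln (real (2 * (m * k) + 1)) \<le> 4 * ln (real k)" .
  then have "real m * ln (real (2 * (m * k) + 1)) \<le> real m * (4 * ln (real k))"
    by (rule mult_left_mono) simp
  moreover have "ln (real k) = ln (real m) + ln (real k / real m)"
    using assms by (simp add: ln_div)
  moreover have "ln (real k / real m) \<le> real k / real m"
    using assms ln_le_minus_one[of "real k / real m"] by simp
  moreover have "real m * ln (real m) \<le> real k * ln (real m)"
    using assms lnm by (intro mult_right_mono) auto
  ultimately have "real m * ln (real (2 * (m * k) + 1)) \<le> 4 * (real k * ln (real m) + real m * (real k / real m))"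
    using mult_left_mono[of "ln (real k / real m)" "real k / real m" "real m"]
    by (simp add: algebra_simps)
  also have "real m * (real k / real m) \<le> real k * (2 * ln (real m))"
    using assms lnm mult_left_mono[of 1 "2 * ln (real m)" "real k"] by simp
  finally show ?thesis
    using assms by (simp add: ln_realpow)
qed

text \<open>For \<open>m = 1\<close> the right side is 0, yet a nondegenerate segment needs several
  small translates; hence \<open>2 \<le> m\<close>. Finiteness is stated separately because
  \<open>the_enat\<close> carries no information at \<open>\<infinity>\<close>.\<close>

theorem proposition2:
  shows "\<exists>C::real. C > 0 \<and>
    (\<forall>(m::nat) (\<epsilon>::real) (p::ennreal) (x :: nat \<Rightarrow> nat \<Rightarrow> real).
       2 \<le> m \<longrightarrow> 0 < \<epsilon> \<longrightarrow> 2 \<le> p \<longrightarrow> (\<forall>i\<in>{1..m}. x i \<in> lp_ball 2) \<longrightarrow>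
       covering_number (absconv (x ` {1..m})) ((*\<^sub>R) \<epsilon> ` lp_ball p) \<noteq> \<infinity> \<and>
       ln (real (the_enat (covering_number (absconv (x ` {1..m})) ((*\<^sub>R) \<epsilon> ` lp_ball p))))
         \<le> C * (ln (real m) / \<epsilon> powr conj_exponent p))"
proof (intro exI[of _ 24] conjI allI impI)
  fix m :: nat and \<epsilon> :: real and p :: ennreal and x :: "nat \<Rightarrow> nat \<Rightarrow> real"
  assume m: "2 \<le> m" and \<epsilon>: "0 < \<epsilon>" and p: "2 \<le> p" and x: "\<forall>i\<in>{1..m}. x i \<in> lp_ball 2"
  let ?K = "absconv (x ` {1..m})" and ?L = "(*\<^sub>R) \<epsilon> ` lp_ball p"
  let ?q = "conj_exponent p"
  have lnm: "0 \<le> ln (real m)"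
    using m by simp
  have X: "x ` {1..m} \<subseteq> lp_ball 2"
    using x by auto
  have "\<exists>T M. finite T \<and> ?K \<subseteq> (\<Union>t\<in>T. (+) t ` ?L) \<and> card T \<le> M \<and> 1 \<le> M \<and>
    ln (real M) \<le> 24 * (ln (real m) / \<epsilon> powr ?q)"
  proof (cases "1 \<le> \<epsilon>")
    \<comment> \<open>The single centre 0 suffices, since the unit ball of l_2 already lies in
      \<open>?L\<close>.\<close>
    case True
    have "lp_ball 2 \<subseteq> ?L"
    proof
      fix f :: "nat \<Rightarrow> real" assume "f \<in> lp_ball 2"
      moreover have "1 \<le> \<epsilon>\<^sup>2"
        using True by simp
      ultimately show "f \<in> ?L"
        using scaled_l2_ball_subset_lp_ball[OF p \<epsilon>, of f] by (auto simp: lp_ball_2_iff)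
    qed
    then have "?K \<subseteq> (\<Union>t\<in>{0}. (+) t ` ?L)"
      using absconv_subset_lp_ball_2[OF X] by auto
    then show ?thesis
      using lnm by (intro exI[of _ "{0}"] exI[of _ 1]) auto
  next
    case False
    define L where "L = 1 / \<epsilon> powr ?q"
    define k where "k = nat \<lceil>L\<rceil>"
    have \<epsilon>q: "\<epsilon> powr ?q \<le> \<epsilon>"
      using powr_mono'[OF conj_exponent_ge_1[OF p], of \<epsilon>] \<epsilon> False by simp
    then have L: "1 \<le> L"
      using False \<epsilon> by (simp add: L_def)
    \<comment> \<open>\<open>1 \<le> L\<close> ensures that rounding up at most doubles
      \<open>L\<close>; this factor turns the constant 12 of both counts into 24.\<close>
    have k: "L \<le> real k" "real k \<le> 2 * L" "1 \<le> k"
      using L unfolding k_def by linarith+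
    have k\<epsilon>: "1 / real k \<le> \<epsilon> powr ?q"
      using k \<epsilon> by (simp add: L_def field_simps)
    have bound: "12 * real k * ln (real m) \<le> 24 * (ln (real m) / \<epsilon> powr ?q)"
      using mult_left_mono[OF mult_right_mono[OF k(2) lnm], of 12] by (simp add: L_def mult_ac)
    show ?thesis
    proof (cases "k \<le> m")
      case True
      have "card (x ` {1..m}) \<le> m"
        using card_image_le[of "{1..m}" x] by simp
      then obtain T where T: "finite T" "?K \<subseteq> (\<Union>t\<in>T. (+) t ` ?L)"
        "card T \<le> (2 * m) ^ k * (8 * m * k\<^sup>2 + 1) ^ k"
        using finite_cover_by_averages[OF _ _ X k(3) p \<epsilon> k\<epsilon>] by blast
      have "card T \<le> m ^ (9 * k)"
        using T(3) averages_count_le[OF m True] by (rule order_trans)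
      moreover have "ln (real (m ^ (9 * k))) \<le> 12 * real k * ln (real m)"
        using m lnm by (simp add: ln_realpow mult_right_mono)
      ultimately show ?thesis
        using T m bound by (intro exI[of _ T] exI[of _ "m ^ (9 * k)"]) auto
    next
      case False
      \<comment> \<open>With grid parameter \<open>m * k\<close> the error is \<open>1 / k\<close>,
        at most \<open>\<epsilon> powr ?q\<close> and so at most \<open>\<epsilon>\<close>.\<close>
      have "real (card {1..m}) / real (m * k) \<le> \<epsilon>"
        using m k\<epsilon> \<epsilon>q by simp
      then obtain T where T: "finite T" "?K \<subseteq> (\<Union>t\<in>T. (+) t ` ?L)"
        "card T \<le> (2 * (m * k) + 1) ^ m"
        using finite_cover_by_coefficient_grid[of "{1..m}" x p \<epsilon> "m * k"] x p \<epsilon> m k by auto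
      have "ln (real ((2 * (m * k) + 1) ^ m)) \<le> 12 * real k * ln (real m)"
        using grid_log_count_le m False by simp
      then show ?thesis
        using T bound by (intro exI[of _ T] exI[of _ "(2 * (m * k) + 1) ^ m"]) auto
    qed
  qed
  then obtain T M where T: "finite T" "?K \<subseteq> (\<Union>t\<in>T. (+) t ` ?L)" "card T \<le> M" "1 \<le> M"
    and M: "ln (real M) \<le> 24 * (ln (real m) / \<epsilon> powr ?q)"
    by blast
  show "covering_number ?K ?L \<noteq> \<infinity>"
    by (rule covering_number_finite_cover(1)[OF T])
  show "ln (real (the_enat (covering_number ?K ?L))) \<le> 24 * (ln (real m) / \<epsilon> powr ?q)"
    using covering_number_finite_cover(2)[OF T] M by (rule order_trans)
qed simp

end
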